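(* R. Thompson's group $F$ admits a normalish amenable subgroup; that is, there exists a subgroup $M \le F$ such that $M$ is amenable and $M$ is normalish in $F$.
   Context: Let $S^1=\mathbb{R}/\mathbb{Z}$. R. Thompson's group $T$ is the group of all orientation-preserving piecewise-linear homeomorphisms of $S^1$ which preserve the set of dyadic rationals $\{a/2^k \mid a,k\in\mathbb{Z}\}$ (taken modulo $\mathbb{Z}$), which admit at most finitely many breaks in slope, all occurring at dyadic rationals, and all of whose affine components have slopes that are integral powers of $2$. R. Thompson's group $F$ is the subgroup of $T$ consisting of the elements that fix the point $0\in S^1$. (Equivalently, $F$ is the group of orientation-preserving piecewise-linear homeomorphisms of $[0,1]$ fixing $0$ and $1$, with finitely many breaks in slope, all at dyadic rationals, and all slopes integral powers of $2$.) Normalish: a subgroup $M$ of a group $G$ is normalish in $G$ if and only if for every finite (nonempty) set $K=\{k_1,k_2,\ldots,k_m\}\subset G$ we have $\bigcap_{i=1}^m M^{k_i}\neq\{1_G\}$, where $M^{k}=k^{-1}Mk$. Amenable means amenable as a discrete group. *)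

theory Defs
  imports "HOL-Analysis.Analysis" "HOL-Algebra.Coset" "HOL-Algebra.Bij"
begin

definition dyadic_rationals :: "real set" where
  "dyadic_rationals = {of_int a / 2 ^ k | (a :: int) (k :: nat). True}"

text \<open>
  \<open>f\<close> is piecewise affine on the unit interval, \<open>B\<close> being a finite set of dyadic rationals that
  contains all breaks in slope: on every subinterval with no point of \<open>B\<close> in its interior,
  \<open>f\<close> is affine with slope an integral power of 2.
\<close>

definition dyadic_piecewise_linear :: "(real \<Rightarrow> real) \<Rightarrow> bool" where
  "dyadic_piecewise_linear f \<longleftrightarrow>
     (\<exists>B. finite B \<and> B \<subseteq> dyadic_rationals \<and>
        (\<forall>a b. 0 \<le> a \<and> a < b \<and> b \<le> 1 \<and> {a<..<b} \<inter> B = {} \<longrightarrow>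
           (\<exists>(n :: int) c. \<forall>x\<in>{a..b}. f x = 2 powi n * x + c)))"

text \<open>
  Self-maps of the unit interval are represented by functions that are \<open>undefined\<close> outside it,
  so that equality of group elements is equality of functions, as in \<open>BijGroup\<close>.
  The product of \<open>g\<close> and \<open>f\<close> is "first \<open>f\<close>, then \<open>g\<close>".
\<close>

definition thompson_F :: "(real \<Rightarrow> real) monoid" where
  "thompson_F = (BijGroup {0..1 :: real})
     \<lparr>carrier := {f \<in> extensional {0..1}.
        (\<exists>g. homeomorphism {0..1} {0..1} f g) \<and> strict_mono_on {0..1} f \<and>
        f 0 = 0 \<and> f 1 = 1 \<and> dyadic_piecewise_linear f}\<rparr>"

definition conjugate_set :: "('a, 'b) monoid_scheme \<Rightarrow> 'a set \<Rightarrow> 'a \<Rightarrow> 'a set" where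
  "conjugate_set G M k = (\<lambda>m. inv\<^bsub>G\<^esub> k \<otimes>\<^bsub>G\<^esub> m \<otimes>\<^bsub>G\<^esub> k) ` M"

definition normalish :: "'a set \<Rightarrow> ('a, 'b) monoid_scheme \<Rightarrow> bool" where
  "normalish M G \<longleftrightarrow> subgroup M G \<and>
     (\<forall>K. finite K \<and> K \<noteq> {} \<and> K \<subseteq> carrier G \<longrightarrow>
        (\<Inter>k\<in>K. conjugate_set G M k) \<noteq> {\<one>\<^bsub>G\<^esub>})"

text \<open>
  Amenability of a discrete group: there is a left-invariant finitely additive probability
  measure defined on all subsets.
\<close>

definition amenable :: "('a, 'b) monoid_scheme \<Rightarrow> bool" where
  "amenable G \<longleftrightarrow> group G \<and>
     (\<exists>\<mu> :: 'a set \<Rightarrow> real.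
        (\<forall>A. A \<subseteq> carrier G \<longrightarrow> 0 \<le> \<mu> A) \<and>
        \<mu> (carrier G) = 1 \<and>
        (\<forall>A B. A \<subseteq> carrier G \<and> B \<subseteq> carrier G \<and> A \<inter> B = {} \<longrightarrow> \<mu> (A \<union> B) = \<mu> A + \<mu> B) \<and>
        (\<forall>g A. g \<in> carrier G \<and> A \<subseteq> carrier G \<longrightarrow> \<mu> (g <#\<^bsub>G\<^esub> A) = \<mu> A))"

end

theory Submission
  imports Defs "HOL-Algebra.Generated_Groups"
begin

text \<open>
  Let \<open>b n\<close> be the copy of a fixed bump, rescaled by \<open>2 ^ -n\<close>, supported on
  \<open>[2 ^ -(n+1), 2 ^ -n]\<close>. The \<open>b n\<close> commute, so they generate an abelian, hence amenable, subgroup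
  \<open>M\<close>. Near 0 an element \<open>k\<close> of \<open>F\<close> is multiplication by some \<open>2 ^ j\<close>, so conjugation by \<open>k\<close>
  shifts the indices of the \<open>b n\<close> with \<open>n\<close> large by \<open>j\<close>. Every conjugate of \<open>M\<close> therefore contains
  almost all \<open>b n\<close>, and so does every finite intersection of conjugates.

  An invariant mean on an abelian group exists by compactness of the space of means: averaging over
  long powers of one element makes a mean almost invariant under that element and, by commutativity,
  preserves almost invariance under the others.
\<close>

no_notation subset_mset (infix "<#" 50)

section \<open>Abelian groups are amenable\<close>

text \<open>The bounds range over all sets of the type, so that the means form a subset of a full
  power of the unit interval, where compactness is available.\<close>

definition (in group) mean :: "('a set \<Rightarrow> real) \<Rightarrow> bool" where
  "mean \<mu> \<longleftrightarrow> (\<forall>A. 0 \<le> \<mu> A \<and> \<mu> A \<le> 1) \<and> \<mu> (carrier G) = 1 \<and>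
     (\<forall>A B. A \<subseteq> carrier G \<and> B \<subseteq> carrier G \<and> A \<inter> B = {} \<longrightarrow> \<mu> (A \<union> B) = \<mu> A + \<mu> B)"

text \<open>Exact invariance under \<open>g\<close> is the conjunction of these closed conditions
  over all \<open>n\<close>, and each single one can be met by averaging.\<close>

definition (in group) almost_invariant :: "'a \<Rightarrow> nat \<Rightarrow> ('a set \<Rightarrow> real) \<Rightarrow> bool" where
  "almost_invariant g n \<mu> \<longleftrightarrow> (\<forall>A\<subseteq>carrier G. \<bar>\<mu> (g <# A) - \<mu> A\<bar> \<le> 1 / real (Suc n))"

lemma (in group) mean_Un:
  "\<lbrakk>mean \<mu>; A \<subseteq> carrier G; B \<subseteq> carrier G; A \<inter> B = {}\<rbrakk> \<Longrightarrow> \<mu> (A \<union> B) = \<mu> A + \<mu> B"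
  by (simp add: mean_def)

lemma (in group) mean_point_mass: "mean (\<lambda>A. if \<one> \<in> A then 1 else 0)"
  by (auto simp: mean_def)

lemma (in group) l_coset_disjoint:
  assumes "g \<in> carrier G" "A \<subseteq> carrier G" "B \<subseteq> carrier G" "A \<inter> B = {}"
  shows "(g <# A) \<inter> (g <# B) = {}"
proof (rule equals0I)
  fix x assume "x \<in> (g <# A) \<inter> (g <# B)"
  then obtain a b where "a \<in> A" "b \<in> B" "g \<otimes> a = g \<otimes> b"
    unfolding l_coset_def by blast
  then show False
    using assms by (metis disjoint_iff subsetD Units_l_cancel Units_eq)
qed

lemma l_coset_Un: "g <#\<^bsub>G\<^esub> (A \<union> B) = (g <#\<^bsub>G\<^esub> A) \<union> (g <#\<^bsub>G\<^esub> B)"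
  by (auto simp: l_coset_def)

lemma (in group) l_coset_carrier_eq: "g \<in> carrier G \<Longrightarrow> g <# carrier G = carrier G"
  by (metis coset_join3 subgroup_self)

text \<open>The Cesaro average along the powers of \<open>g\<close>, with \<open>n + 1\<close> terms
  to match the tolerance \<open>1 / (n + 1)\<close>.\<close>

definition (in group) average :: "'a \<Rightarrow> nat \<Rightarrow> ('a set \<Rightarrow> real) \<Rightarrow> 'a set \<Rightarrow> real" where
  "average g n \<mu> A = (\<Sum>j\<le>n. \<mu> ((g [^] j) <# A)) / real (Suc n)"

lemma (in group) mean_average:
  assumes "mean \<mu>" "g \<in> carrier G"
  shows "mean (average g n \<mu>)"
proof -
  have "0 \<le> average g n \<mu> A" for A
    using assms(1) by (auto simp: average_def mean_def intro!: divide_nonneg_nonneg sum_nonneg)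
  moreover have "average g n \<mu> A \<le> 1" for A
  proof -
    have "(\<Sum>j\<le>n. \<mu> ((g [^] j) <# A)) \<le> (\<Sum>j\<le>n. 1)"
      using assms(1) by (intro sum_mono) (auto simp: mean_def)
    then show ?thesis by (simp add: average_def)
  qed
  moreover have "average g n \<mu> (carrier G) = 1"
    using assms by (simp add: average_def l_coset_carrier_eq mean_def)
  moreover have "average g n \<mu> (A \<union> B) = average g n \<mu> A + average g n \<mu> B"
    if AB: "A \<subseteq> carrier G" "B \<subseteq> carrier G" "A \<inter> B = {}" for A B
  proof -
    have "\<mu> (g [^] j <# (A \<union> B)) = \<mu> (g [^] j <# A) + \<mu> (g [^] j <# B)" for j :: nat
      unfolding l_coset_Un
      using assms AB by (intro mean_Un l_coset_disjoint l_coset_subset_G) simp_all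
    then show ?thesis
      by (simp add: average_def sum.distrib add_divide_distrib)
  qed
  ultimately show ?thesis by (simp add: mean_def)
qed

text \<open>Replacing \<open>A\<close> by \<open>g <# A\<close> shifts the summation index by one,
  so the difference telescopes to two boundary values of \<mu>, which are at most 1 apart; division
  by \<open>n + 1\<close> gives the bound.\<close>

lemma (in group) almost_invariant_average:
  assumes "mean \<mu>" "g \<in> carrier G"
  shows "almost_invariant g n (average g n \<mu>)"
  unfolding almost_invariant_def
proof (intro allI impI)
  fix A assume A: "A \<subseteq> carrier G"
  have "(\<Sum>j\<le>n. \<mu> (g [^] j <# (g <# A))) = (\<Sum>j\<le>n. \<mu> (g [^] Suc j <# A))"
    using assms A by (intro sum.cong) (auto simp: lcos_m_assoc)
  then have "(\<Sum>j\<le>n. \<mu> (g [^] j <# (g <# A))) - (\<Sum>j\<le>n. \<mu> (g [^] j <# A))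
      = \<mu> (g [^] Suc n <# A) - \<mu> (g [^] (0::nat) <# A)"
    using sum_telescope[of "\<lambda>j. \<mu> (g [^] j <# A)" n] by (simp only: sum_subtractf)
  moreover have "\<bar>\<mu> X - \<mu> Y\<bar> \<le> 1" for X Y
  proof -
    have "0 \<le> \<mu> X" "\<mu> X \<le> 1" "0 \<le> \<mu> Y" "\<mu> Y \<le> 1"
      using assms(1) by (simp_all add: mean_def)
    then show ?thesis by linarith
  qed
  ultimately have "\<bar>(\<Sum>j\<le>n. \<mu> (g [^] j <# (g <# A))) - (\<Sum>j\<le>n. \<mu> (g [^] j <# A))\<bar> \<le> 1"
    by presburger
  then show "\<bar>average g n \<mu> (g <# A) - average g n \<mu> A\<bar> \<le> 1 / real (Suc n)"
    unfolding average_def by (simp add: diff_divide_distrib[symmetric] divide_right_mono)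
qed

text \<open>Commutativity enters here: powers of \<open>g\<close> commute with \<open>h\<close>, so
  every summand changes by at most \<open>1 / (m + 1)\<close>, and hence so does the
  average.\<close>

lemma (in comm_group) almost_invariant_average_other:
  assumes "almost_invariant h m \<mu>" "g \<in> carrier G" "h \<in> carrier G"
  shows "almost_invariant h m (average g n \<mu>)"
  unfolding almost_invariant_def
proof (intro allI impI)
  fix A assume A: "A \<subseteq> carrier G"
  have *: "\<bar>\<mu> (g [^] j <# (h <# A)) - \<mu> (g [^] j <# A)\<bar> \<le> 1 / real (Suc m)" for j :: nat
  proof -
    have "g [^] j <# (h <# A) = h <# (g [^] j <# A)"
      using assms A by (simp add: lcos_m_assoc m_comm)
    then show ?thesis
      using assms A by (simp add: almost_invariant_def l_coset_subset_G)
  qed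
  have "\<bar>(\<Sum>j\<le>n. \<mu> (g [^] j <# (h <# A))) - (\<Sum>j\<le>n. \<mu> (g [^] j <# A))\<bar>
      \<le> (\<Sum>j\<le>n. 1 / real (Suc m))"
    unfolding sum_subtractf[symmetric] by (rule order_trans[OF sum_abs sum_mono[OF *]])
  then have "\<bar>(\<Sum>j\<le>n. \<mu> (g [^] j <# (h <# A))) - (\<Sum>j\<le>n. \<mu> (g [^] j <# A))\<bar> / real (Suc n)
      \<le> (\<Sum>j\<le>n. 1 / real (Suc m)) / real (Suc n)"
    by (rule divide_right_mono) simp
  then show "\<bar>average g n \<mu> (h <# A) - average g n \<mu> A\<bar> \<le> 1 / real (Suc m)"
    unfolding average_def diff_divide_distrib[symmetric] by (simp del: of_nat_Suc)
qed

text \<open>One constraint is added at a time: averaging for the new pair \<open>p\<close> secures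
  its constraint and does not spoil those already obtained.\<close>

lemma (in comm_group) ex_almost_invariant_mean:
  assumes "finite S" "S \<subseteq> carrier G \<times> UNIV"
  shows "\<exists>\<mu>. mean \<mu> \<and> (\<forall>p\<in>S. almost_invariant (fst p) (snd p) \<mu>)"
  using assms
proof (induction S rule: finite_induct)
  case empty
  then show ?case using mean_point_mass by blast
next
  case (insert p S)
  have p: "fst p \<in> carrier G" and S: "S \<subseteq> carrier G \<times> UNIV"
    using insert.prems by auto
  from insert.IH[OF S] obtain \<mu>
    where \<mu>: "mean \<mu>" "\<And>q. q \<in> S \<Longrightarrow> almost_invariant (fst q) (snd q) \<mu>" by blast
  show ?case
  proof (intro exI conjI ballI)
    show "mean (average (fst p) (snd p) \<mu>)"
      using \<mu>(1) p by (rule mean_average)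
    fix q assume "q \<in> insert p S"
    then consider "q = p" | "q \<in> S" by blast
    then show "almost_invariant (fst q) (snd q) (average (fst p) (snd p) \<mu>)"
    proof cases
      case 1
      then show ?thesis using \<mu>(1) p by (simp add: almost_invariant_average)
    next
      case 2
      then have "fst q \<in> carrier G" using S by auto
      with 2 \<mu>(2) p show ?thesis by (simp add: almost_invariant_average_other)
    qed
  qed
qed

section \<open>Compactness and passage to an exactly invariant mean\<close>

text \<open>Tychonoff's theorem: the set is a power of \<open>{0..1}\<close>, and the topology on
  functions is the product topology.\<close>

lemma compact_functions_unit_interval: "compact {\<mu> :: 'a \<Rightarrow> real. \<forall>A. 0 \<le> \<mu> A \<and> \<mu> A \<le> 1}"
proof -
  have "{\<mu> :: 'a \<Rightarrow> real. \<forall>A. 0 \<le> \<mu> A \<and> \<mu> A \<le> 1} = PiE UNIV (\<lambda>_. {0..1})"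
    by (simp add: PiE_def Pi_def)
  moreover have "compactin (product_topology (\<lambda>_. euclidean) UNIV) (PiE UNIV (\<lambda>_::'a. {0..1::real}))"
    by (simp only: compactin_PiE compactin_euclidean_iff compact_Icc simp_thms ball_simps)
  ultimately show ?thesis
    by (simp only: euclidean_product_topology compactin_euclidean_iff)
qed

text \<open>Each instance of normalization or additivity involves finitely many coordinates of
  \<mu>, so together they cut out a closed subset of a compact space.\<close>

lemma (in group) compact_means: "compact {\<mu>. mean \<mu>}"
proof -
  have "closed {\<mu> :: 'a set \<Rightarrow> real. \<mu> (carrier G) = 1 \<and>
     (\<forall>A B. A \<subseteq> carrier G \<and> B \<subseteq> carrier G \<and> A \<inter> B = {} \<longrightarrow> \<mu> (A \<union> B) = \<mu> A + \<mu> B)}"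
    by (intro closed_Collect_conj closed_Collect_all closed_Collect_imp open_Collect_const
        closed_Collect_eq continuous_intros continuous_on_product_coordinates)
  from compact_Int_closed[OF compact_functions_unit_interval this]
  show ?thesis by (simp add: mean_def Collect_conj_eq Int_assoc)
qed

lemma (in group) closed_almost_invariant: "closed {\<mu>. almost_invariant g n \<mu>}"
  unfolding almost_invariant_def
  by (intro closed_Collect_all closed_Collect_imp open_Collect_const
        closed_Collect_le continuous_intros continuous_on_product_coordinates)

text \<open>Any finitely many almost-invariance constraints are met by some mean; by the finite
  intersection property a single mean meets all of them.\<close>

lemma (in comm_group) amenable: "amenable G"
proof -
  have "{\<mu>. mean \<mu>} \<inter> (\<Inter>p\<in>carrier G \<times> UNIV. {\<mu>. almost_invariant (fst p) (snd p) \<mu>}) \<noteq> {}"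
  proof (rule compact_imp_fip_image[OF compact_means])
    fix S assume "finite S" "S \<subseteq> carrier G \<times> (UNIV :: nat set)"
    then show "{\<mu>. mean \<mu>} \<inter> (\<Inter>p\<in>S. {\<mu>. almost_invariant (fst p) (snd p) \<mu>}) \<noteq> {}"
      using ex_almost_invariant_mean[of S] by simp blast
  qed (rule closed_almost_invariant)
  then obtain \<mu> where \<mu>: "mean \<mu>" and inv: "\<And>g n. g \<in> carrier G \<Longrightarrow> almost_invariant g n \<mu>"
    by fastforce
  have "\<mu> (g <# A) = \<mu> A" if "g \<in> carrier G" "A \<subseteq> carrier G" for g A
  \<comment> \<open>A nonzero discrepancy would exceed some \<open>1 / (n + 1)\<close>, against
    almost invariance for that \<open>n\<close>.\<close>
  proof (rule ccontr)
    assume "\<mu> (g <# A) \<noteq> \<mu> A"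
    then obtain n where "inverse (real (Suc n)) < \<bar>\<mu> (g <# A) - \<mu> A\<bar>"
      using reals_Archimedean[of "\<bar>\<mu> (g <# A) - \<mu> A\<bar>"] by auto
    with inv[OF that(1), of n] that show False
      by (auto simp: almost_invariant_def inverse_eq_divide simp del: of_nat_Suc)
  qed
  moreover have "0 \<le> \<mu> A" for A
    using \<mu> by (simp add: mean_def)
  moreover have "\<mu> (carrier G) = 1"
    using \<mu> by (simp add: mean_def)
  ultimately show ?thesis
    unfolding amenable_def using mean_Un[OF \<mu>] group_axioms by (intro conjI exI[of _ \<mu>]) simp_all
qed

section \<open>The group structure of Thompson's group F\<close>

text \<open>Clearing denominators reduces closure properties of the dyadics to those of the
  integers.\<close>

lemma dyadic_rationals_iff: "x \<in> dyadic_rationals \<longleftrightarrow> (\<exists>k::nat. x * 2 ^ k \<in> \<int>)"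
proof
  assume "x \<in> dyadic_rationals"
  then obtain a :: int and k :: nat where "x = of_int a / 2 ^ k"
    unfolding dyadic_rationals_def by blast
  then have "x * 2 ^ k = of_int a" by simp
  then show "\<exists>k::nat. x * 2 ^ k \<in> \<int>" by (metis Ints_of_int)
next
  assume "\<exists>k::nat. x * 2 ^ k \<in> \<int>"
  then obtain a :: int and k :: nat where "x * 2 ^ k = of_int a"
    by (auto elim: Ints_cases)
  then have "x = of_int a / 2 ^ k" by (simp add: field_simps)
  then show "x \<in> dyadic_rationals" unfolding dyadic_rationals_def by blast
qed

lemma dyadic_rationals_0: "0 \<in> dyadic_rationals"
  by (simp add: dyadic_rationals_iff)

lemma dyadic_rationals_diff:
  assumes "x \<in> dyadic_rationals" "y \<in> dyadic_rationals"
  shows "x - y \<in> dyadic_rationals"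
proof -
  obtain k l where kl: "x * 2 ^ k \<in> \<int>" "y * 2 ^ l \<in> \<int>"
    using assms unfolding dyadic_rationals_iff by blast
  have "(x - y) * 2 ^ (k + l) = (x * 2 ^ k) * 2 ^ l - (y * 2 ^ l) * 2 ^ k"
    by (simp add: power_add algebra_simps)
  moreover have "\<dots> \<in> \<int>"
    by (intro Ints_diff Ints_mult[OF kl(1)] Ints_mult[OF kl(2)]) auto
  ultimately show ?thesis unfolding dyadic_rationals_iff by metis
qed

lemma dyadic_rationals_add:
  assumes "x \<in> dyadic_rationals" "y \<in> dyadic_rationals"
  shows "x + y \<in> dyadic_rationals"
  using dyadic_rationals_diff[OF assms(1) dyadic_rationals_diff[OF dyadic_rationals_0 assms(2)]]
  by simp

lemma dyadic_rationals_scale: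
  assumes "x \<in> dyadic_rationals"
  shows "2 powi n * x \<in> dyadic_rationals"
proof -
  obtain k where k: "x * 2 ^ k \<in> \<int>"
    using assms unfolding dyadic_rationals_iff by blast
  \<comment> \<open>The factor \<open>2 ^ nat \<bar>n\<bar>\<close> clears the denominator whichever
    sign \<open>n\<close> has.\<close>
  have "(2::real) powi n * 2 ^ nat \<bar>n\<bar> \<in> \<int>"
  proof (cases "0 \<le> n")
    case True
    then show ?thesis by (simp add: power_int_def)
  next
    case False
    then show ?thesis by (simp add: power_int_def power_one_over)
  qed
  then have "(x * 2 ^ k) * (2 powi n * 2 ^ nat \<bar>n\<bar>) \<in> \<int>"
    using k by (rule Ints_mult[rotated])
  then have "2 powi n * x * 2 ^ (k + nat \<bar>n\<bar>) \<in> \<int>"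
    by (simp add: power_add mult_ac)
  then show ?thesis unfolding dyadic_rationals_iff by blast
qed

text \<open>An affine map whose slope is a power of 2 and which sends one dyadic to a dyadic has an
  inverse of the same kind, so it both preserves and reflects dyadic points.\<close>

lemma dyadic_rationals_affine_iff:
  assumes "y - b = 2 powi n * (x - a)" "a \<in> dyadic_rationals" "b \<in> dyadic_rationals"
  shows "y \<in> dyadic_rationals \<longleftrightarrow> x \<in> dyadic_rationals"
proof
  assume "x \<in> dyadic_rationals"
  then have "2 powi n * (x - a) + b \<in> dyadic_rationals"
    using assms(2,3) by (intro dyadic_rationals_add dyadic_rationals_scale dyadic_rationals_diff)
  then show "y \<in> dyadic_rationals"
    using assms(1) by (metis diff_add_cancel)
next
  assume "y \<in> dyadic_rationals"
  then have "2 powi (-n) * (y - b) + a \<in> dyadic_rationals"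
    using assms(2,3) by (intro dyadic_rationals_add dyadic_rationals_scale dyadic_rationals_diff)
  moreover have "2 powi (-n) * (y - b) + a = x"
    unfolding assms(1) by (simp add: power_int_minus mult.assoc[symmetric])
  ultimately show "x \<in> dyadic_rationals" by simp
qed

section \<open>Breakpoint sets and dyadic points\<close>

text \<open>Keeps the breakpoint set visible, because it has to be constructed for composites and
  inverses. \<open>B\<close> only has to contain the breaks and may be larger.\<close>

definition affine_pieces :: "(real \<Rightarrow> real) \<Rightarrow> real set \<Rightarrow> bool" where
  "affine_pieces f B \<longleftrightarrow> (\<forall>a b. 0 \<le> a \<and> a < b \<and> b \<le> 1 \<and> {a<..<b} \<inter> B = {} \<longrightarrow>
     (\<exists>(n :: int) c. \<forall>x\<in>{a..b}. f x = 2 powi n * x + c))"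

lemma dyadic_piecewise_linear_iff:
  "dyadic_piecewise_linear f \<longleftrightarrow> (\<exists>B. finite B \<and> B \<subseteq> dyadic_rationals \<and> affine_pieces f B)"
  unfolding dyadic_piecewise_linear_def affine_pieces_def ..

lemma dyadic_piecewise_linearI:
  "\<lbrakk>finite B; B \<subseteq> dyadic_rationals; affine_pieces f B\<rbrakk> \<Longrightarrow> dyadic_piecewise_linear f"
  unfolding dyadic_piecewise_linear_iff by blast

lemma affine_piecesE:
  assumes "affine_pieces f B" "0 \<le> a" "a < b" "b \<le> 1" "{a<..<b} \<inter> B = {}"
  obtains n :: int and c where "\<And>x. a \<le> x \<Longrightarrow> x \<le> b \<Longrightarrow> f x = 2 powi n * x + c"
proof -
  have "\<exists>(n :: int) c. \<forall>x\<in>{a..b}. f x = 2 powi n * x + c"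
    using assms(1-5) unfolding affine_pieces_def by blast
  then show ?thesis using that by auto
qed

text \<open>Dyadicity is carried from 0 to \<open>x\<close> one affine piece at a time, by induction
  on the number of breaks in between. This later shows that the breaks of composites and inverses
  are dyadic.\<close>

lemma dyadic_image_iff:
  assumes "finite B" "B \<subseteq> dyadic_rationals" "affine_pieces f B" "f 0 = 0" "0 \<le> x" "x \<le> 1"
  shows "f x \<in> dyadic_rationals \<longleftrightarrow> x \<in> dyadic_rationals"
  using assms(5,6)
proof (induction "card (B \<inter> {0<..<x})" arbitrary: x rule: less_induct)
  case less
  show ?case
  proof (cases "x = 0")
    case True
    then show ?thesis using assms(4) by simp
  next
    case False
    \<comment> \<open>The last break before \<open>x\<close>, or 0 if there is none, so that
      \<open>f\<close> is affine on \<open>{a..x}\<close>.\<close>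
    define a where "a = Max (insert 0 (B \<inter> {0<..<x}))"
    have fin: "finite (insert 0 (B \<inter> {0<..<x}))" using assms(1) by simp
    have "a \<in> insert 0 (B \<inter> {0<..<x})"
      unfolding a_def by (rule Max_in[OF fin]) simp
    then have a: "0 \<le> a" "a < x" "a \<in> dyadic_rationals" "a = 0 \<or> a \<in> B \<inter> {0<..<x}"
      using False less.prems assms(2) dyadic_rationals_0 by (auto simp del: Max_insert)
    have "{a<..<x} \<inter> B = {}"
    proof (rule equals0I)
      fix y assume y: "y \<in> {a<..<x} \<inter> B"
      then have "y \<in> insert 0 (B \<inter> {0<..<x})" using a(1) by auto
      then have "y \<le> a" unfolding a_def by (rule Max_ge[OF fin])
      then show False using y by auto
    qed
    then obtain n c where f: "\<And>y. a \<le> y \<Longrightarrow> y \<le> x \<Longrightarrow> f y = 2 powi n * y + c"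
      using affine_piecesE[OF assms(3) a(1,2) less.prems(2)] by blast
    have "f a \<in> dyadic_rationals"
    proof (cases "a = 0")
      case True
      then show ?thesis using assms(4) dyadic_rationals_0 by simp
    next
      case False
      \<comment> \<open>\<open>a\<close> itself is a break in \<open>{0<..<x}\<close> but not in
        \<open>{0<..<a}\<close>, so the count drops.\<close>
      then have "B \<inter> {0<..<a} \<subset> B \<inter> {0<..<x}" using a by auto
      then have "card (B \<inter> {0<..<a}) < card (B \<inter> {0<..<x})"
        using assms(1) by (intro psubset_card_mono) auto
      then show ?thesis using less.hyps[of a] a less.prems by auto
    qed
    moreover have "f x - f a = 2 powi n * (x - a)"
      using f[of x] f[of a] a by (simp add: right_diff_distrib)
    ultimately show ?thesis
      using a(3) dyadic_rationals_affine_iff by blast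
  qed
qed

section \<open>Closure under composition and inverses\<close>

text \<open>The inverse homeomorphism comes for free: the intermediate value theorem gives
  surjectivity, and a continuous injection on a compact interval has a continuous inverse.\<close>

lemma mem_thompson_F_iff:
  "f \<in> carrier thompson_F \<longleftrightarrow> f \<in> extensional {0..1} \<and> continuous_on {0..1} f \<and>
     strict_mono_on {0..1} f \<and> f 0 = 0 \<and> f 1 = 1 \<and> dyadic_piecewise_linear f" (is "?L \<longleftrightarrow> ?R")
proof
  assume ?L
  then show ?R
    unfolding thompson_F_def by (auto dest: homeomorphism_cont1)
next
  assume R: ?R
  have "f ` {0..1} = {0..1}"
  proof
    show "f ` {0..1} \<subseteq> {0..1}"
    proof
      fix y assume "y \<in> f ` {0..1}"
      then obtain x where "x \<in> {0..1}" "y = f x" by blast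
      then show "y \<in> {0..1}"
        using R strict_mono_on_leD[of "{0..1}" f 0 x] strict_mono_on_leD[of "{0..1}" f x 1] by simp
    qed
    show "{0..1} \<subseteq> f ` {0..1}"
    proof
      fix y :: real assume "y \<in> {0..1}"
      then obtain x where "0 \<le> x" "x \<le> 1" "f x = y"
        using IVT'[of f 0 y 1] R by auto
      then show "y \<in> f ` {0..1}" by auto
    qed
  qed
  then have "\<exists>g. homeomorphism {0..1} {0..1} f g"
    using R by (intro homeomorphism_compact strict_mono_on_imp_inj_on) simp_all
  then show ?L using R unfolding thompson_F_def by simp
qed

lemma thompson_F_bij_betw: "f \<in> carrier thompson_F \<Longrightarrow> bij_betw f {0..1} {0..1}"
  by (auto simp: thompson_F_def bij_betw_def homeomorphism_def intro: strict_mono_on_imp_inj_on)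

lemma thompson_F_less_iff:
  assumes "f \<in> carrier thompson_F" "x \<in> {0..1}" "y \<in> {0..1}"
  shows "f x < f y \<longleftrightarrow> x < y"
  using assms strict_mono_on_less[of "{0..1}" f x y] by (simp add: mem_thompson_F_iff)

lemma thompson_F_mem: "f \<in> carrier thompson_F \<Longrightarrow> x \<in> {0..1} \<Longrightarrow> f x \<in> {0..1}"
  using bij_betwE[OF thompson_F_bij_betw] by blast

lemma thompson_F_inv_into:
  assumes "f \<in> carrier thompson_F" "y \<in> {0..1}"
  shows "inv_into {0..1} f y \<in> {0..1}" "f (inv_into {0..1} f y) = y"
  using assms thompson_F_bij_betw[of f]
  by (simp_all add: bij_betw_def inv_into_into f_inv_into_f del: atLeastAtMost_iff)

text \<open>The composite can break only at a break of \<open>f\<close> or where \<open>f\<close>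
  meets a break of \<open>g\<close>; points of the second kind are dyadic because \<open>f\<close>
  reflects dyadic points.\<close>

lemma compose_mem_thompson_F:
  assumes g: "g \<in> carrier thompson_F" and f: "f \<in> carrier thompson_F"
  shows "compose {0..1} g f \<in> carrier thompson_F"
proof -
  let ?h = "compose {0..1} g f"
  have h: "?h x = g (f x)" if "x \<in> {0..1}" for x
    using that by (simp add: compose_def)
  obtain B where B: "finite B" "B \<subseteq> dyadic_rationals" "affine_pieces f B"
    using f unfolding mem_thompson_F_iff dyadic_piecewise_linear_iff by blast
  obtain C where C: "finite C" "C \<subseteq> dyadic_rationals" "affine_pieces g C"
    using g unfolding mem_thompson_F_iff dyadic_piecewise_linear_iff by blast
  define D where "D = B \<union> (f -` C \<inter> {0..1})"
  have "finite D"
    using thompson_F_bij_betw[OF f] B(1) C(1) unfolding D_def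
    by (intro finite_UnI finite_vimage_IntI) (simp_all add: bij_betw_def)
  moreover have "D \<subseteq> dyadic_rationals"
  proof
    fix x assume "x \<in> D"
    then consider "x \<in> B" | "f x \<in> C" "x \<in> {0..1}" unfolding D_def by blast
    then show "x \<in> dyadic_rationals"
    proof cases
      case 1
      then show ?thesis using B(2) by blast
    next
      case 2
      then show ?thesis
        using C(2) f dyadic_image_iff[OF B, of x] by (auto simp: mem_thompson_F_iff)
    qed
  qed
  moreover have "affine_pieces ?h D"
    unfolding affine_pieces_def
  proof (intro allI impI)
    fix a b :: real assume ab: "0 \<le> a \<and> a < b \<and> b \<le> 1 \<and> {a<..<b} \<inter> D = {}"
    then obtain n c where n: "\<And>x. a \<le> x \<Longrightarrow> x \<le> b \<Longrightarrow> f x = 2 powi n * x + c"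
      using affine_piecesE[OF B(3), of a b] unfolding D_def by blast
    have I: "f a \<in> {0..1}" "f b \<in> {0..1}" "f a < f b"
      using ab thompson_F_mem[OF f] thompson_F_less_iff[OF f] by auto
    \<comment> \<open>A break \<open>y\<close> of \<open>g\<close> in this interval would be
      \<open>f x\<close> for some \<open>x\<close> strictly between \<open>a\<close> and
      \<open>b\<close>, and that \<open>x\<close> would lie in \<open>D\<close>.\<close>
    have "{f a<..<f b} \<inter> C = {}"
    proof (rule equals0I)
      fix y assume y: "y \<in> {f a<..<f b} \<inter> C"
      define x where "x = inv_into {0..1} f y"
      have "y \<in> {0..1}" using y I by auto
      then have x: "x \<in> {0..1}" "f x = y"
        using thompson_F_inv_into[OF f] unfolding x_def by auto
      with y ab have "a < x" "x < b"
        using thompson_F_less_iff[OF f, of a x] thompson_F_less_iff[OF f, of x b] by auto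
      with x y ab show False unfolding D_def by auto
    qed
    then obtain m d where m: "\<And>x. f a \<le> x \<Longrightarrow> x \<le> f b \<Longrightarrow> g x = 2 powi m * x + d"
      using affine_piecesE[OF C(3), of "f a" "f b"] I by auto
    have "?h x = 2 powi (m + n) * x + (2 powi m * c + d)" if "x \<in> {a..b}" for x
    proof -
      have "f a \<le> f x" "f x \<le> f b"
        using n[of a] n[of b] n[of x] that ab by simp_all
      then show ?thesis
        using that ab m[of "f x"] n[of x] by (simp add: h power_int_add algebra_simps)
    qed
    then show "\<exists>(n::int) c. \<forall>x\<in>{a..b}. ?h x = 2 powi n * x + c" by blast
  qed
  ultimately have "dyadic_piecewise_linear ?h"
    by (rule dyadic_piecewise_linearI)
  moreover have "continuous_on {0..1} ?h"
  proof -
    have "continuous_on {0..1} f" "continuous_on {0..1} g"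
      using f g by (simp_all add: mem_thompson_F_iff)
    moreover have "f ` {0..1} \<subseteq> {0..1}"
      using thompson_F_mem[OF f] by blast
    ultimately have "continuous_on {0..1} (\<lambda>x. g (f x))"
      by (blast intro: continuous_on_compose2)
    then show ?thesis
      by (rule continuous_on_eq) (simp add: h)
  qed
  moreover have "strict_mono_on {0..1} ?h"
  proof (rule strict_mono_onI)
    fix x y :: real assume xy: "x \<in> {0..1}" "y \<in> {0..1}" "x < y"
    then show "?h x < ?h y"
      unfolding h[OF xy(1)] h[OF xy(2)]
      by (simp only: thompson_F_less_iff[OF g] thompson_F_less_iff[OF f] thompson_F_mem[OF f])
  qed
  ultimately show ?thesis
    using f g h by (simp add: mem_thompson_F_iff)
qed

text \<open>The inverse can break only at images of breaks of \<open>f\<close>, and these are dyadic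
  because \<open>f\<close> preserves dyadic points.\<close>

lemma inverse_mem_thompson_F:
  assumes f: "f \<in> carrier thompson_F"
  shows "restrict (inv_into {0..1} f) {0..1} \<in> carrier thompson_F"
proof -
  let ?h = "restrict (inv_into {0..1} f) {0..1}"
  have h: "?h y \<in> {0..1}" "f (?h y) = y" if "y \<in> {0..1}" for y
    using thompson_F_inv_into[OF f that] that by (simp_all del: atLeastAtMost_iff)
  have h_eq: "?h (f x) = x" if "x \<in> {0..1}" for x
    using thompson_F_bij_betw[OF f] thompson_F_mem[OF f that] that
    by (simp add: bij_betw_def inv_into_f_f del: atLeastAtMost_iff)
  have f01: "f 0 = 0" "f 1 = 1" using f by (auto simp: mem_thompson_F_iff)
  have less: "?h x < ?h y" if "x \<in> {0..1}" "y \<in> {0..1}" "x < y" for x y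
    using thompson_F_less_iff[OF f h(1)[OF that(1)] h(1)[OF that(2)]] h(2) that by simp
  obtain B where B: "finite B" "B \<subseteq> dyadic_rationals" "affine_pieces f B"
    using f unfolding mem_thompson_F_iff dyadic_piecewise_linear_iff by blast
  \<comment> \<open>Values of \<open>f\<close> at points of \<open>B\<close> outside the unit
    interval are not controlled, so these points are left out.\<close>
  define D where "D = f ` (B \<inter> {0..1})"
  have "finite D" using B(1) by (simp add: D_def)
  moreover have "D \<subseteq> dyadic_rationals"
  proof
    fix y assume "y \<in> D"
    then obtain x where "x \<in> B" "x \<in> {0..1}" "y = f x" unfolding D_def by blast
    then show "y \<in> dyadic_rationals"
      using B(2) f01 dyadic_image_iff[OF B, of x] by auto
  qed
  moreover have "affine_pieces ?h D"
    unfolding affine_pieces_def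
  proof (intro allI impI)
    fix a b :: real assume ab: "0 \<le> a \<and> a < b \<and> b \<le> 1 \<and> {a<..<b} \<inter> D = {}"
    then have ha: "?h a \<in> {0..1}" "f (?h a) = a" and hb: "?h b \<in> {0..1}" "f (?h b) = b"
      and hab: "?h a < ?h b"
      using h[of a] h[of b] less[of a b] by (simp_all del: restrict_apply)
    have "{?h a<..<?h b} \<inter> B = {}"
    proof (rule equals0I)
      fix x assume x: "x \<in> {?h a<..<?h b} \<inter> B"
      then have x01: "x \<in> {0..1}" using ha hb by (auto simp del: restrict_apply)
      have "a < f x" "f x < b"
        using thompson_F_less_iff[OF f ha(1) x01] thompson_F_less_iff[OF f x01 hb(1)] x ha hb
        by (simp_all del: restrict_apply)
      moreover have "f x \<in> D" using x x01 by (simp add: D_def)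
      ultimately show False using ab by auto
    qed
    then obtain n c where n: "\<And>x. ?h a \<le> x \<Longrightarrow> x \<le> ?h b \<Longrightarrow> f x = 2 powi n * x + c"
      using affine_piecesE[OF B(3) _ hab] ha hb by (auto simp del: restrict_apply)
    \<comment> \<open>The affine formula for \<open>f\<close> is solved for \<open>?h y\<close>; the
      slope exponent changes sign.\<close>
    have "?h y = 2 powi (-n) * y + (- (2 powi (-n) * c))" if "y \<in> {a..b}" for y
    proof -
      have y: "y \<in> {0..1}" using that ab by auto
      have "?h a \<le> ?h y" "?h y \<le> ?h b"
        using that ab y less[of a y] less[of y b] by (force simp del: restrict_apply)+
      then have "y = 2 powi n * ?h y + c"
        using n[of "?h y"] h(2)[OF y] by simp
      then have "2 powi (-n) * (y - c) = 2 powi (-n) * (2 powi n * ?h y)" by simp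
      also have "\<dots> = ?h y" by (simp add: power_int_minus mult.assoc[symmetric] del: restrict_apply)
      finally show ?thesis by (simp add: algebra_simps)
    qed
    then show "\<exists>(n::int) c. \<forall>x\<in>{a..b}. ?h x = 2 powi n * x + c" by blast
  qed
  ultimately have "dyadic_piecewise_linear ?h"
    by (rule dyadic_piecewise_linearI)
  moreover have "continuous_on {0..1} ?h"
  proof -
    have "continuous_on (f ` {0..1}) ?h"
      using f h_eq by (intro continuous_on_inv) (auto simp: mem_thompson_F_iff simp del: restrict_apply)
    then show ?thesis using thompson_F_bij_betw[OF f] by (simp add: bij_betw_def)
  qed
  moreover have "strict_mono_on {0..1} ?h"
    using less by (rule strict_mono_onI)
  moreover have "?h 0 = 0" "?h 1 = 1"
    using h_eq[of 0] h_eq[of 1] f01 by auto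
  ultimately show ?thesis
    unfolding mem_thompson_F_iff by simp
qed

lemma affine_pieces_id: "affine_pieces (\<lambda>x\<in>{0..1}. x) {}"
  unfolding affine_pieces_def by (intro allI impI exI[of _ 0] ballI) auto

lemma subgroup_thompson_F: "subgroup (carrier thompson_F) (BijGroup {0..1})"
proof (rule group.subgroupI[OF group_BijGroup])
  have Bij: "f \<in> Bij {0..1}" if "f \<in> carrier thompson_F" for f
    using that thompson_F_bij_betw[OF that] by (simp add: Bij_def mem_thompson_F_iff)
  then show "carrier thompson_F \<subseteq> carrier (BijGroup {0..1})"
    by (auto simp: BijGroup_def)
  have "continuous_on {0..1} (\<lambda>x\<in>{0..1}. x :: real)"
    by (metis (no_types, lifting) continuous_on_cong continuous_on_id restrict_apply')
  moreover have "dyadic_piecewise_linear (\<lambda>x\<in>{0..1}. x)"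
    using affine_pieces_id unfolding dyadic_piecewise_linear_iff by (intro exI[of _ "{}"]) simp
  ultimately have "(\<lambda>x\<in>{0..1}. x) \<in> carrier thompson_F"
    by (simp add: mem_thompson_F_iff strict_mono_on_def)
  then show "carrier thompson_F \<noteq> {}" by blast
  fix f assume f: "f \<in> carrier thompson_F"
  then show "inv\<^bsub>BijGroup {0..1}\<^esub> f \<in> carrier thompson_F"
    using inverse_mem_thompson_F Bij by (simp add: inv_BijGroup)
  fix g assume "g \<in> carrier thompson_F"
  then show "f \<otimes>\<^bsub>BijGroup {0..1}\<^esub> g \<in> carrier thompson_F"
    using f compose_mem_thompson_F Bij by (simp add: BijGroup_def)
qed

text \<open>Brings \<open>thompson_F\<close> into the shape in which
  \<open>subgroup.subgroup_is_group\<close> presents a subgroup as a group.\<close>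

lemma thompson_F_eq: "thompson_F = (BijGroup {0..1})\<lparr>carrier := carrier thompson_F\<rparr>"
  unfolding thompson_F_def by simp

lemma group_thompson_F: "group thompson_F"
  using subgroup.subgroup_is_group[OF subgroup_thompson_F group_BijGroup] thompson_F_eq by simp

lemma thompson_F_mult:
  assumes "f \<in> carrier thompson_F" "g \<in> carrier thompson_F"
  shows "f \<otimes>\<^bsub>thompson_F\<^esub> g = compose {0..1} f g"
proof -
  have "h \<in> Bij {0..1}" if "h \<in> carrier thompson_F" for h
    using that subgroup.subset[OF subgroup_thompson_F] by (auto simp: BijGroup_def)
  then show ?thesis
    using assms unfolding thompson_F_def by (simp add: BijGroup_def)
qed

lemma thompson_F_one: "\<one>\<^bsub>thompson_F\<^esub> = (\<lambda>x\<in>{0..1}. x)"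
  unfolding thompson_F_def by (simp add: BijGroup_def)

section \<open>The group generated by the rescaled bumps\<close>

text \<open>The centralizer of \<open>x\<close> is a subgroup, so once it contains \<open>H\<close>
  it contains everything that \<open>H\<close> generates.\<close>

lemma (in group) generate_commute:
  assumes H: "H \<subseteq> carrier G" and x: "x \<in> carrier G" and y: "y \<in> generate G H"
    and comm: "\<And>h. h \<in> H \<Longrightarrow> x \<otimes> h = h \<otimes> x"
  shows "x \<otimes> y = y \<otimes> x"
  using y
proof (induction rule: generate.induct)
  case one
  then show ?case using x by simp
next
  case (incl h)
  then show ?case by (rule comm)
next
  case (inv h)
  then have h: "h \<in> carrier G" using H by blast
  \<comment> \<open>The relation \<open>x \<otimes> h = h \<otimes> x\<close> is multiplied by
    \<open>inv h\<close> on both sides.\<close>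
  have "inv h \<otimes> (x \<otimes> h) \<otimes> inv h = inv h \<otimes> (h \<otimes> x) \<otimes> inv h"
    by (simp only: comm[OF inv])
  then show ?case using x h by (simp add: m_assoc inv_solve_left)
next
  case (eng y z)
  then have "y \<in> carrier G" "z \<in> carrier G" using generate_in_carrier[OF H] by auto
  then show ?case using eng.IH x by (metis m_assoc)
qed

text \<open>The centralizer argument is used twice: first a generator commutes with the whole
  subgroup, then so does an arbitrary element of it.\<close>

lemma (in group) comm_group_generate:
  assumes H: "H \<subseteq> carrier G" and comm: "\<And>x y. x \<in> H \<Longrightarrow> y \<in> H \<Longrightarrow> x \<otimes> y = y \<otimes> x"
  shows "comm_group (G\<lparr>carrier := generate G H\<rparr>)"
proof (rule group.group_comm_groupI)
  show "group (G\<lparr>carrier := generate G H\<rparr>)"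
    using generate_is_subgroup[OF H] by (rule subgroup.subgroup_is_group) (rule group_axioms)
  have "h \<otimes> y = y \<otimes> h" if "h \<in> H" "y \<in> generate G H" for h y
    using generate_commute[OF H _ that(2)] subsetD[OF H that(1)] comm[OF that(1)] by blast
  then have "x \<otimes> y = y \<otimes> x" if "x \<in> generate G H" "y \<in> generate G H" for x y
    using generate_commute[OF H generate_in_carrier[OF H that(1)] that(2)] that(1) by metis
  then show "\<And>x y. \<lbrakk>x \<in> carrier (G\<lparr>carrier := generate G H\<rparr>); y \<in> carrier (G\<lparr>carrier := generate G H\<rparr>)\<rbrakk>
      \<Longrightarrow> x \<otimes>\<^bsub>G\<lparr>carrier := generate G H\<rparr>\<^esub> y = y \<otimes>\<^bsub>G\<lparr>carrier := generate G H\<rparr>\<^esub> x"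
    by simp
qed

section \<open>Piecewise linear bumps and their commutation\<close>

text \<open>
  Supported on \<open>[1/2, 1]\<close>, with slopes 1/2, 1 and 2 on \<open>[1/2, 3/4]\<close>, \<open>[3/4, 7/8]\<close> and \<open>[7/8, 1]\<close>.
\<close>

definition bump :: "real \<Rightarrow> real" where
  "bump x = min x (max (x / 2 + 1 / 4) (max (x - 1 / 8) (2 * x - 1)))"

text \<open>The conjugate of \<open>bump\<close> by the dilation by \<open>2 ^ n\<close>: slopes are
  kept, and the supports for distinct \<open>n\<close> share at most an endpoint.\<close>

definition scaled_bump :: "nat \<Rightarrow> real \<Rightarrow> real" where
  "scaled_bump n x = bump (2 ^ n * x) / 2 ^ n"

definition bump_elt :: "nat \<Rightarrow> real \<Rightarrow> real" where
  "bump_elt n = restrict (scaled_bump n) {0..1}"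

text \<open>The inner maximum in \<open>bump\<close> is a convex function that lies below the
  identity exactly between 1/2 and 1; the outer \<open>min\<close> replaces it by the identity
  elsewhere.\<close>

lemma bump_fix: "x \<le> 1 / 2 \<or> 1 \<le> x \<Longrightarrow> bump x = x"
  unfolding bump_def by (auto simp: min_def max_def)

lemma bump_le: "bump x \<le> x"
  unfolding bump_def by simp

lemma bump_gt_half: "1 / 2 < x \<Longrightarrow> 1 / 2 < bump x"
  unfolding bump_def by (auto simp: min_def max_def)

lemma bump_less: "x < y \<Longrightarrow> bump x < bump y"
  unfolding bump_def by (auto simp: min_def max_def)

lemma bump_nonneg: "0 \<le> x \<Longrightarrow> 0 \<le> bump x"
  unfolding bump_def by (auto simp: min_def max_def)

lemma bump_affine:
  assumes "a < b" "{a<..<b} \<inter> {1/2, 3/4, 7/8, 1} = {}"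
  shows "\<exists>(n :: int) c. \<forall>x\<in>{a..b}. bump x = 2 powi n * x + c"
proof -
  \<comment> \<open>An interval with no break in its interior lies in one of the five cells cut out
    by the four breaks.\<close>
  have "p \<le> a \<or> b \<le> p" if "p \<in> {1/2, 3/4, 7/8, 1}" for p
    using assms(2) that by force
  from this[of "1/2"] this[of "3/4"] this[of "7/8"] this[of 1]
  consider "b \<le> 1/2" | "1/2 \<le> a" "b \<le> 3/4" | "3/4 \<le> a" "b \<le> 7/8" | "7/8 \<le> a" "b \<le> 1" | "1 \<le> a"
    by auto
  then show ?thesis
  proof cases
    case 1
    then have "\<forall>x\<in>{a..b}. bump x = 2 powi 0 * x + 0" by (auto simp: bump_fix)
    then show ?thesis by blast
  next
    case 2
    then have "\<forall>x\<in>{a..b}. bump x = 2 powi (-1) * x + 1/4" by (auto simp: bump_def min_def max_def)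
    then show ?thesis by blast
  next
    case 3
    then have "\<forall>x\<in>{a..b}. bump x = 2 powi 0 * x + (- 1/8)" by (auto simp: bump_def min_def max_def)
    then show ?thesis by blast
  next
    case 4
    then have "\<forall>x\<in>{a..b}. bump x = 2 powi 1 * x + (- 1)" by (auto simp: bump_def min_def max_def)
    then show ?thesis by blast
  next
    case 5
    then have "\<forall>x\<in>{a..b}. bump x = 2 powi 0 * x + 0" by (auto simp: bump_fix)
    then show ?thesis by blast
  qed
qed

lemma scaled_bump_fix_left: "2 ^ n * x \<le> 1 / 2 \<Longrightarrow> scaled_bump n x = x"
  unfolding scaled_bump_def by (simp add: bump_fix)

lemma scaled_bump_fix_right: "1 \<le> 2 ^ n * x \<Longrightarrow> scaled_bump n x = x"
  unfolding scaled_bump_def by (simp add: bump_fix)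

lemma scaled_bump_le: "scaled_bump n x \<le> x"
  using bump_le[of "2 ^ n * x"] unfolding scaled_bump_def by (simp add: field_simps)

lemma scaled_bump_less: "x < y \<Longrightarrow> scaled_bump n x < scaled_bump n y"
  unfolding scaled_bump_def by (intro divide_strict_right_mono bump_less) simp_all

lemma scaled_bump_nonneg: "0 \<le> x \<Longrightarrow> 0 \<le> scaled_bump n x"
  unfolding scaled_bump_def by (intro divide_nonneg_nonneg bump_nonneg mult_nonneg_nonneg) simp_all

lemma scaled_bump_mem: "x \<in> {0..1} \<Longrightarrow> scaled_bump n x \<in> {0..1}"
  using scaled_bump_le[of n x] scaled_bump_nonneg[of x n] by simp

lemma bump_elt_apply: "x \<in> {0..1} \<Longrightarrow> bump_elt n x = scaled_bump n x"
  unfolding bump_elt_def by simp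

lemma affine_pieces_bump_elt:
  "affine_pieces (bump_elt n) ((\<lambda>p. p / 2 ^ n) ` {1/2, 3/4, 7/8, 1})"
  unfolding affine_pieces_def
proof (intro allI impI)
  fix a b :: real
  assume ab: "0 \<le> a \<and> a < b \<and> b \<le> 1 \<and> {a<..<b} \<inter> (\<lambda>p. p / 2 ^ n) ` {1/2, 3/4, 7/8, 1} = {}"
  have "{2 ^ n * a<..<2 ^ n * b} \<inter> {1/2, 3/4, 7/8, 1} = {}"
  proof (rule equals0I)
    fix p assume p: "p \<in> {2 ^ n * a<..<2 ^ n * b} \<inter> {1/2, 3/4, 7/8, 1}"
    then have "p / 2 ^ n \<in> {a<..<b}" by (simp add: field_simps)
    then show False using ab p by blast
  qed
  moreover have "2 ^ n * a < 2 ^ n * b" using ab by simp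
  ultimately have "\<exists>(m :: int) c. \<forall>x\<in>{2 ^ n * a..2 ^ n * b}. bump x = 2 powi m * x + c"
    by (intro bump_affine)
  then obtain m :: int and c where m: "\<forall>x\<in>{2 ^ n * a..2 ^ n * b}. bump x = 2 powi m * x + c"
    by blast
  have "bump_elt n x = 2 powi m * x + c / 2 ^ n" if "x \<in> {a..b}" for x
  proof -
    have "bump (2 ^ n * x) = 2 powi m * (2 ^ n * x) + c"
      using m that by simp
    then show ?thesis
      using that ab by (simp add: bump_elt_def scaled_bump_def add_divide_distrib)
  qed
  then show "\<exists>(m::int) c. \<forall>x\<in>{a..b}. bump_elt n x = 2 powi m * x + c" by blast
qed

lemma bump_elt_mem_thompson_F: "bump_elt n \<in> carrier thompson_F"
  unfolding mem_thompson_F_iff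
proof (intro conjI)
  show "bump_elt n \<in> extensional {0..1}"
    unfolding bump_elt_def by simp
  have "continuous_on {0..1} (scaled_bump n)"
    unfolding scaled_bump_def bump_def by (intro continuous_intros) simp_all
  then show "continuous_on {0..1} (bump_elt n)"
    by (rule continuous_on_eq) (simp add: bump_elt_apply)
  show "strict_mono_on {0..1} (bump_elt n)"
  proof (rule strict_mono_onI)
    fix x y :: real assume xy: "x \<in> {0..1}" "y \<in> {0..1}" "x < y"
    then show "bump_elt n x < bump_elt n y"
      unfolding bump_elt_apply[OF xy(1)] bump_elt_apply[OF xy(2)] by (intro scaled_bump_less)
  qed
  show "bump_elt n 0 = 0"
    using scaled_bump_fix_left[of n 0] by (simp add: bump_elt_apply)
  show "bump_elt n 1 = 1"
    using scaled_bump_fix_right[of n 1] by (simp add: bump_elt_apply)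
  have dyadic: "p / 2 ^ n \<in> dyadic_rationals" if "p \<in> {1/2, 3/4, 7/8, 1}" for p
  proof -
    \<comment> \<open>All four breaks of \<open>bump\<close> are multiples of 1/8, so
      \<open>2 ^ (n + 3)\<close> clears the denominators of the rescaled ones.\<close>
    have "8 * p \<in> {4, 6, 7, 8}" using that by auto
    moreover have "{4, 6, 7, 8} \<subseteq> (\<int> :: real set)" by simp
    ultimately have "8 * p \<in> \<int>" by blast
    then have "p / 2 ^ n * 2 ^ (n + 3) \<in> \<int>" by (simp add: power_add mult.commute)
    then show ?thesis unfolding dyadic_rationals_iff by blast
  qed
  show "dyadic_piecewise_linear (bump_elt n)"
  proof (rule dyadic_piecewise_linearI[OF _ _ affine_pieces_bump_elt])
    show "finite ((\<lambda>p. p / 2 ^ n) ` {1/2, 3/4, 7/8, 1 :: real})" by simp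
    show "(\<lambda>p. p / 2 ^ n) ` {1/2, 3/4, 7/8, 1} \<subseteq> dyadic_rationals"
      using dyadic by blast
  qed
qed

lemma bump_elt_not_one: "bump_elt n \<noteq> \<one>\<^bsub>thompson_F\<^esub>"
proof
  \<comment> \<open>The midpoint of the support of \<open>bump_elt n\<close>; it is moved because
    \<open>bump\<close> sends 3/4 to 5/8.\<close>
  define x :: real where "x = 3 / 4 / 2 ^ n"
  have x: "x \<in> {0..1}"
    using one_le_power[of "2::real" n] by (auto simp: x_def field_simps simp del: one_le_power)
  assume "bump_elt n = \<one>\<^bsub>thompson_F\<^esub>"
  then have "bump_elt n x = x"
    using x by (simp add: thompson_F_one)
  then have "bump (2 ^ n * x) = 2 ^ n * x"
    unfolding bump_elt_apply[OF x] scaled_bump_def by (simp add: field_simps)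
  moreover have "2 ^ n * x = 3 / 4" by (simp add: x_def)
  ultimately have "bump (3 / 4) = 3 / 4" by simp
  then show False by (simp add: bump_def)
qed

text \<open>For \<open>n < m\<close> the support of the \<open>m\<close>-th bump lies to the left of
  that of the \<open>n\<close>-th. Left of \<open>1 / 2 ^ (n + 1)\<close> the \<open>m\<close>-th
  bump only moves points down, where the \<open>n\<close>-th is the identity; right of it the
  \<open>n\<close>-th bump never crosses back, and the \<open>m\<close>-th is the identity.\<close>

lemma scaled_bump_commute_less:
  assumes "n < m" "0 \<le> x"
  shows "scaled_bump n (scaled_bump m x) = scaled_bump m (scaled_bump n x)"
proof -
  \<comment> \<open>Since \<open>Suc n \<le> m\<close>, a point beyond the left end of the
    \<open>n\<close>-th support is beyond the right end of the \<open>m\<close>-th.\<close>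
  have double: "1 < 2 ^ m * y" if "1 / 2 < 2 ^ n * y" for y :: real
  proof -
    have "(2::real) ^ Suc n \<le> 2 ^ m" using assms(1) by (intro power_increasing) auto
    moreover have "0 < y" using that by (smt (verit) zero_less_mult_pos zero_less_power half_gt_zero)
    ultimately have "2 ^ Suc n * y \<le> 2 ^ m * y" by (intro mult_right_mono) auto
    then show ?thesis using that by simp
  qed
  show ?thesis
  proof (cases "2 ^ n * x \<le> 1 / 2")
    case True
    have "2 ^ n * scaled_bump m x \<le> 2 ^ n * x"
      by (intro mult_left_mono scaled_bump_le) simp
    with True have "2 ^ n * scaled_bump m x \<le> 1 / 2" by linarith
    with True show ?thesis by (simp only: scaled_bump_fix_left)
  next
    case False
    then have "1 / 2 < 2 ^ n * scaled_bump n x"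
      using bump_gt_half[of "2 ^ n * x"] by (simp add: scaled_bump_def)
    then have "1 \<le> 2 ^ m * x" "1 \<le> 2 ^ m * scaled_bump n x"
      using False double[of x] double[of "scaled_bump n x"] by linarith+
    then show ?thesis by (simp only: scaled_bump_fix_right)
  qed
qed

lemma bump_elt_commute:
  "bump_elt n \<otimes>\<^bsub>thompson_F\<^esub> bump_elt m = bump_elt m \<otimes>\<^bsub>thompson_F\<^esub> bump_elt n"
proof -
  have "scaled_bump n (scaled_bump m x) = scaled_bump m (scaled_bump n x)" if "0 \<le> x" for x
    using that scaled_bump_commute_less[of n m x] scaled_bump_commute_less[of m n x]
    by (cases n m rule: linorder_cases) auto
  then have "bump_elt n (bump_elt m x) = bump_elt m (bump_elt n x)" if "x \<in> {0..1}" for x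
    using that scaled_bump_mem by (simp add: bump_elt_apply del: atLeastAtMost_iff) simp
  then show ?thesis
    by (simp add: thompson_F_mult bump_elt_mem_thompson_F compose_def restrict_def fun_eq_iff)
qed

section \<open>Germs at 0 and conjugation of bumps\<close>

text \<open>There is no break between 0 and the least positive one, and fixing 0 forces the constant
  term on that piece to vanish.\<close>

lemma thompson_F_linear_near_0:
  assumes k: "k \<in> carrier thompson_F"
  obtains e :: real and j :: int where "0 < e" "e \<le> 1" "\<And>x. 0 \<le> x \<Longrightarrow> x \<le> e \<Longrightarrow> k x = 2 powi j * x"
proof -
  obtain B where B: "finite B" "affine_pieces k B" and k0: "k 0 = 0"
    using k unfolding mem_thompson_F_iff dyadic_piecewise_linear_iff by blast
  \<comment> \<open>Only positive breaks count, as 0 may belong to \<open>B\<close>; inserting 1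
    makes the set nonempty and keeps \<open>e\<close> in the unit interval.\<close>
  define e where "e = Min (insert 1 (B \<inter> {0<..}))"
  have fin: "finite (insert 1 (B \<inter> {0<..}))" using B(1) by simp
  have "e \<in> insert 1 (B \<inter> {0<..})"
    unfolding e_def by (rule Min_in[OF fin]) simp
  then have e0: "0 < e" by auto
  have e1: "e \<le> 1" unfolding e_def by (rule Min_le[OF fin]) simp
  have "{0<..<e} \<inter> B = {}"
  proof (rule equals0I)
    fix y assume y: "y \<in> {0<..<e} \<inter> B"
    then have "y \<in> insert 1 (B \<inter> {0<..})" by auto
    then have "e \<le> y" unfolding e_def by (rule Min_le[OF fin])
    then show False using y by auto
  qed
  then obtain j c where j: "\<And>x. 0 \<le> x \<Longrightarrow> x \<le> e \<Longrightarrow> k x = 2 powi j * x + c"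
    using affine_piecesE[OF B(2) _ e0 e1] by auto
  have "c = 0" using j[of 0] k0 e0 by simp
  with j that[OF e0 e1, of j] show ?thesis by simp
qed

text \<open>Multiplication by \<open>2 powi j\<close> carries the support of the \<open>n\<close>-th
  bump onto that of the \<open>m\<close>-th, and \<open>bump\<close> is rescaled accordingly. Beyond
  these supports both bumps are the identity, so the form of \<open>k\<close> away from 0 is
  irrelevant.\<close>

lemma conjugate_bump_elt:
  assumes k: "k \<in> carrier thompson_F"
    and lin: "\<And>x. 0 \<le> x \<Longrightarrow> x \<le> e \<Longrightarrow> k x = 2 powi j * x"
    and n: "1 / 2 ^ n \<le> e" and m: "int m = int n - j"
  shows "k \<otimes>\<^bsub>thompson_F\<^esub> bump_elt n = bump_elt m \<otimes>\<^bsub>thompson_F\<^esub> k"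
proof -
  \<comment> \<open>Equivalently, \<open>k\<close> sends the right end \<open>1 / 2 ^ n\<close> of
    one support to the right end \<open>1 / 2 ^ m\<close> of the other.\<close>
  have mn: "2 ^ m * 2 powi j = (2 :: real) ^ n"
  proof -
    have "(2 :: real) powi int m * 2 powi j = 2 powi int n"
      unfolding m by (simp flip: power_int_add)
    then show ?thesis by simp
  qed
  have "k (scaled_bump n x) = scaled_bump m (k x)" if x: "x \<in> {0..1}" for x
  proof (cases "x \<le> 1 / 2 ^ n")
    case True
    \<comment> \<open>Bumps never move points up, so the image of \<open>x\<close> stays in the
      range where \<open>k\<close> is linear.\<close>
    then have "k (scaled_bump n x) = 2 powi j * scaled_bump n x"
      using scaled_bump_le[of n x] scaled_bump_mem[OF x, of n] n by (intro lin) auto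
    also have "\<dots> = bump (2 ^ n * x) / 2 ^ m"
      unfolding scaled_bump_def mn[symmetric] by simp
    also have "\<dots> = scaled_bump m (k x)"
      using lin[of x] x True n unfolding scaled_bump_def mn[symmetric] by (simp add: mult.assoc)
    finally show ?thesis .
  next
    case False
    have n01: "1 / 2 ^ n \<in> {0..1 :: real}" by simp
    \<comment> \<open>By monotonicity, \<open>k x\<close> lies beyond the \<open>m\<close>-th
      support when \<open>x\<close> lies beyond the \<open>n\<close>-th.\<close>
    have "k (1 / 2 ^ n) \<le> k x"
      using thompson_F_less_iff[OF k n01 x] False by simp
    then have "2 ^ m * k (1 / 2 ^ n) \<le> 2 ^ m * k x" by simp
    moreover have "2 ^ m * k (1 / 2 ^ n) = 1"
      using lin[of "1 / 2 ^ n"] n mn by simp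
    ultimately have "scaled_bump m (k x) = k x" by (intro scaled_bump_fix_right) simp
    moreover have "scaled_bump n x = x"
      using False by (intro scaled_bump_fix_right) (simp add: field_simps)
    ultimately show ?thesis by simp
  qed
  then have "k (bump_elt n x) = bump_elt m (k x)" if "x \<in> {0..1}" for x
    using that thompson_F_mem[OF k that] by (simp add: bump_elt_apply del: atLeastAtMost_iff)
  then show ?thesis
    by (simp add: thompson_F_mult bump_elt_mem_thompson_F k compose_def restrict_def fun_eq_iff)
qed

section \<open>The bump group is abelian and normalish\<close>

definition bump_group :: "(real \<Rightarrow> real) set" where
  "bump_group = generate thompson_F (range bump_elt)"

lemma range_bump_elt: "range bump_elt \<subseteq> carrier thompson_F"
  using bump_elt_mem_thompson_F by blast

lemma subgroup_bump_group: "subgroup bump_group thompson_F"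
  unfolding bump_group_def by (rule group.generate_is_subgroup[OF group_thompson_F range_bump_elt])

lemma comm_group_bump_group: "comm_group (thompson_F\<lparr>carrier := bump_group\<rparr>)"
  unfolding bump_group_def using bump_elt_commute
  by (intro group.comm_group_generate[OF group_thompson_F range_bump_elt]) blast

text \<open>For large \<open>n\<close>, the \<open>n\<close>-th support lies in the linear range of
  \<open>k\<close> at 0, and the intertwining relation exhibits \<open>bump_elt n\<close> as the
  conjugate by \<open>k\<close> of another generator.\<close>

lemma eventually_bump_elt_in_conjugate:
  assumes k: "k \<in> carrier thompson_F"
  shows "\<forall>\<^sub>F n in sequentially. bump_elt n \<in> conjugate_set thompson_F bump_group k"
proof -
  interpret group thompson_F by (rule group_thompson_F)
  obtain e :: real and j :: int
    where e: "0 < e" and lin: "\<And>x. 0 \<le> x \<Longrightarrow> x \<le> e \<Longrightarrow> k x = 2 powi j * x"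
    using thompson_F_linear_near_0[OF k] by blast
  obtain N where N: "(1 / 2) ^ N < e"
    using real_arch_pow_inv[OF e, of "1 / 2"] by auto
  have "bump_elt n \<in> conjugate_set thompson_F bump_group k" if "max N (nat j) \<le> n" for n
  proof -
    have "(1 / 2 :: real) ^ n \<le> (1 / 2) ^ N"
      using that by (intro power_decreasing) auto
    then have ne: "1 / 2 ^ n \<le> e" using N by (simp add: power_one_over)
    \<comment> \<open>The bound \<open>nat j \<le> n\<close> makes the difference nonnegative, so
      \<open>nat\<close> truncates nothing.\<close>
    define m where "m = nat (int n - j)"
    have m: "int m = int n - j" using that unfolding m_def by linarith
    have "k \<otimes>\<^bsub>thompson_F\<^esub> bump_elt n = bump_elt m \<otimes>\<^bsub>thompson_F\<^esub> k"
      by (rule conjugate_bump_elt[OF k lin ne m])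
    then have "bump_elt n = inv\<^bsub>thompson_F\<^esub> k \<otimes>\<^bsub>thompson_F\<^esub> (bump_elt m \<otimes>\<^bsub>thompson_F\<^esub> k)"
      using k bump_elt_mem_thompson_F inv_solve_left by (metis m_closed)
    then have "bump_elt n = inv\<^bsub>thompson_F\<^esub> k \<otimes>\<^bsub>thompson_F\<^esub> bump_elt m \<otimes>\<^bsub>thompson_F\<^esub> k"
      using k bump_elt_mem_thompson_F by (simp add: m_assoc)
    moreover have "bump_elt m \<in> bump_group"
      unfolding bump_group_def by (intro generate.incl rangeI)
    ultimately show ?thesis unfolding conjugate_set_def by blast
  qed
  then show ?thesis unfolding eventually_sequentially by blast
qed

text \<open>Finitely many eventual memberships hold simultaneously, so one nontrivial bump lies in
  all the conjugates.\<close>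

lemma normalish_bump_group: "normalish bump_group thompson_F"
  unfolding normalish_def
proof (intro conjI allI impI)
  show "subgroup bump_group thompson_F" by (rule subgroup_bump_group)
  fix K assume K: "finite K \<and> K \<noteq> {} \<and> K \<subseteq> carrier thompson_F"
  then have "\<forall>\<^sub>F n in sequentially. \<forall>k\<in>K. bump_elt n \<in> conjugate_set thompson_F bump_group k"
    by (intro eventually_ball_finite ballI eventually_bump_elt_in_conjugate) auto
  then obtain n where "\<forall>k\<in>K. bump_elt n \<in> conjugate_set thompson_F bump_group k"
    unfolding eventually_sequentially by blast
  then have "bump_elt n \<in> (\<Inter>k\<in>K. conjugate_set thompson_F bump_group k)" by blast
  then show "(\<Inter>k\<in>K. conjugate_set thompson_F bump_group k) \<noteq> {\<one>\<^bsub>thompson_F\<^esub>}"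
    using bump_elt_not_one by blast
qed

theorem theorem1:
  "\<exists>M. subgroup M thompson_F \<and> amenable (thompson_F\<lparr>carrier := M\<rparr>) \<and> normalish M thompson_F"
  using subgroup_bump_group comm_group.amenable[OF comm_group_bump_group] normalish_bump_group
  by blast

end
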